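(* Let $X^*\in\mathbb{R}_+^{n\times m}$ be a nonzero nonnegative matrix with $\mathrm{rank}_+(X^* )=\mathrm{rank}(X^* )=:r^*$, observed as $X=X^*+N$, and suppose $\|N\|_F\le\frac{\sigma_{r^*}(X^* )}{5}$. Let $\lambda>0$ satisfy $$\lambda\in\left[\tfrac12\|N\|_F^2,\ \tfrac1{32}\big(\sigma_{r^*}(X^* )-\|N\|_F\big)^2\right].$$ Then for all sufficiently small $\mu>0$ (that is, there is $\mu_0>0$ depending only on $X^*,N,\lambda$ such that for every $\mu\in(0,\mu_0)$), any critical point $(\overline U,\overline V)$ of $\Psi_{\lambda,\mu}$ satisfying $$\Psi_{\lambda,\mu}(\overline U,\overline V)\le\tfrac12\|N\|_F^2+\mu\sqrt{r^*}\,\|X^*\|_F+2\lambda r^*$$ exactly recovers the true rank: $\mathrm{rank}_+(\overline U\,\overline V^\top)=r^*$.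
   Context: $n,m,r$ are positive integers and the observed data matrix $X$ is in $\mathbb{R}_+^{n\times m}$. $\|\cdot\|_F$ is the Frobenius norm, $\sigma_i(\cdot)$ the $i$-th largest singular value, $\|W\|_{2,0}$ the number of nonzero columns of $W$; $\delta_{\mathbb{R}_+}(W)=0$ if $W\ge0$ entrywise and $+\infty$ otherwise. For $(U,V)\in\mathbb{R}^{n\times r}\times\mathbb{R}^{m\times r}$, $$\Psi_{\lambda,\mu}(U,V)=\tfrac12\|X-UV^\top\|_F^2+\tfrac\mu2(\|U\|_F^2+\|V\|_F^2)+\lambda(\|U\|_{2,0}+\|V\|_{2,0})+\delta_{\mathbb{R}_+}(U)+\delta_{\mathbb{R}_+}(V).$$ A critical point is a point where $0$ belongs to the limiting (Mordukhovich) subdifferential. The nonnegative rank $\mathrm{rank}_+(A)$ of an entrywise nonnegative matrix $A$ is the smallest integer $s$ such that $A=BC^\top$ with $B,C$ entrywise nonnegative having $s$ columns. *)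

theory Defs
  imports "HOL-Analysis.Analysis"
begin

text \<open>
  Matrices of fixed size n x m have type \<^typ>\<open>real^'m^'n\<close>; their \<^const>\<open>norm\<close> is the Frobenius
  norm. A matrix whose number r of columns is a natural number (so that r can be quantified
  inside a formula) is the sequence of its columns, padded with zeros from index r on.
\<close>

definition column_seqs :: "nat \<Rightarrow> (nat \<Rightarrow> 'a::zero) set" where
  "column_seqs r = {U. \<forall>j\<ge>r. U j = 0}"

definition cinner :: "nat \<Rightarrow> (nat \<Rightarrow> 'a::real_inner) \<Rightarrow> (nat \<Rightarrow> 'a) \<Rightarrow> real" where
  "cinner r U V = (\<Sum>j<r. U j \<bullet> V j)"

definition cnorm :: "nat \<Rightarrow> (nat \<Rightarrow> 'a::real_normed_vector) \<Rightarrow> real" where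
  "cnorm r U = L2_set (\<lambda>j. norm (U j)) {..<r}"

text \<open>The product of U with the transpose of V.\<close>

definition mult_transpose ::
    "nat \<Rightarrow> (nat \<Rightarrow> real^'n) \<Rightarrow> (nat \<Rightarrow> real^'m) \<Rightarrow> real^'m^'n" where
  "mult_transpose r U V = (\<chi> i k. \<Sum>j<r. U j $ i * V j $ k)"

definition nonneg_columns :: "nat \<Rightarrow> (nat \<Rightarrow> real^'n) \<Rightarrow> bool" where
  "nonneg_columns r U \<longleftrightarrow> (\<forall>j<r. \<forall>i. 0 \<le> U j $ i)"

definition nonneg_matrix :: "real^'m^'n \<Rightarrow> bool" where
  "nonneg_matrix A \<longleftrightarrow> (\<forall>i j. 0 \<le> A $ i $ j)"

text \<open>Meaningful for entrywise nonnegative matrices only.\<close>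

definition nonneg_rank :: "real^'m^'n \<Rightarrow> nat" where
  "nonneg_rank A = (LEAST s. \<exists>B\<in>column_seqs s. \<exists>C\<in>column_seqs s.
     nonneg_columns s B \<and> nonneg_columns s C \<and> A = mult_transpose s B C)"

text \<open>
  Singular values are the square roots of the eigenvalues of \<open>A\<^sup>T A\<close>. As that matrix is
  symmetric, the multiplicity is the dimension of the eigenspace. The k-th largest singular
  value (counting from 1) is the largest s such that at least k singular values, counted with
  multiplicity, are at least s.
\<close>

definition singular_space :: "real^'m^'n \<Rightarrow> real \<Rightarrow> (real^'m) set" where
  "singular_space A s = {v. (transpose A ** A) *v v = s\<^sup>2 *\<^sub>R v}"

definition singular_values :: "real^'m^'n \<Rightarrow> real set" where
  "singular_values A = {s. 0 \<le> s \<and> (\<exists>v\<in>singular_space A s. v \<noteq> 0)}"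

definition singular_value :: "nat \<Rightarrow> real^'m^'n \<Rightarrow> real" where
  "singular_value k A = Max {s \<in> singular_values A.
     k \<le> (\<Sum>t\<in>{t \<in> singular_values A. s \<le> t}. dim (singular_space A t))}"

definition norm20 :: "nat \<Rightarrow> (nat \<Rightarrow> 'a::zero) \<Rightarrow> nat" where
  "norm20 r U = card {j. j < r \<and> U j \<noteq> 0}"

definition nonneg_indicator :: "nat \<Rightarrow> (nat \<Rightarrow> real^'n) \<Rightarrow> ereal" where
  "nonneg_indicator r U = (if nonneg_columns r U then 0 else \<infinity>)"

definition Psi :: "real^'m^'n \<Rightarrow> real \<Rightarrow> real \<Rightarrow> nat \<Rightarrow>
    (nat \<Rightarrow> real^'n) \<Rightarrow> (nat \<Rightarrow> real^'m) \<Rightarrow> ereal" where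
  "Psi X lam mu r U V =
     ereal (1/2 * (norm (X - mult_transpose r U V))\<^sup>2
            + mu/2 * ((cnorm r U)\<^sup>2 + (cnorm r V)\<^sup>2)
            + lam * (real (norm20 r U) + real (norm20 r V)))
     + nonneg_indicator r U + nonneg_indicator r V"

text \<open>
  Frechet (regular) and limiting (Mordukhovich) subdifferentials of an extended-real-valued
  function on the Euclidean space \<open>E\<^sup>r\<close>, realised as \<^term>\<open>column_seqs r :: (nat \<Rightarrow> 'a::real_inner) set\<close>.
  The regular one expresses \<open>f Z \<ge> f W + \<langle>G, Z - W\<rangle> + o(\<parallel>Z - W\<parallel>)\<close>.
\<close>

definition regular_subdifferential ::
    "nat \<Rightarrow> ((nat \<Rightarrow> 'a::real_inner) \<Rightarrow> ereal) \<Rightarrow> (nat \<Rightarrow> 'a) \<Rightarrow> (nat \<Rightarrow> 'a) set" where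
  "regular_subdifferential r f W = {G \<in> column_seqs r. \<bar>f W\<bar> \<noteq> \<infinity> \<and>
     (\<forall>\<epsilon>>0. \<exists>\<delta>>0. \<forall>Z\<in>column_seqs r. cnorm r (\<lambda>j. Z j - W j) < \<delta> \<longrightarrow>
        f W + ereal (cinner r G (\<lambda>j. Z j - W j) - \<epsilon> * cnorm r (\<lambda>j. Z j - W j)) \<le> f Z)}"

definition limiting_subdifferential ::
    "nat \<Rightarrow> ((nat \<Rightarrow> 'a::real_inner) \<Rightarrow> ereal) \<Rightarrow> (nat \<Rightarrow> 'a) \<Rightarrow> (nat \<Rightarrow> 'a) set" where
  "limiting_subdifferential r f W = {G \<in> column_seqs r. \<bar>f W\<bar> \<noteq> \<infinity> \<and>
     (\<exists>W' G'. (\<forall>k. W' k \<in> column_seqs r \<and> G' k \<in> regular_subdifferential r f (W' k)) \<and>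
        (\<lambda>k. cnorm r (\<lambda>j. W' k j - W j)) \<longlonglongrightarrow> 0 \<and>
        (\<lambda>k. f (W' k)) \<longlonglongrightarrow> f W \<and>
        (\<lambda>k. cnorm r (\<lambda>j. G' k j - G j)) \<longlonglongrightarrow> 0)}"

text \<open>
  A pair (U, V) of matrices with r columns each is identified, isometrically, with the sequence
  of the pairs of their columns.
\<close>

definition critical_point :: "nat \<Rightarrow>
    ((nat \<Rightarrow> 'a::real_inner) \<Rightarrow> (nat \<Rightarrow> 'b::real_inner) \<Rightarrow> ereal) \<Rightarrow>
    (nat \<Rightarrow> 'a) \<Rightarrow> (nat \<Rightarrow> 'b) \<Rightarrow> bool" where
  "critical_point r F U V \<longleftrightarrow>
     (\<lambda>_. 0) \<in> limiting_subdifferential r (\<lambda>W. F (fst \<circ> W) (snd \<circ> W)) (\<lambda>j. (U j, V j))"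

end

theory Submission
  imports Defs
begin

text \<open>
  Write \<open>Y = U V\<^sup>T\<close>, \<open>\<sigma> = \<sigma>\<^sub>r(X\<^sup>*)\<close> with \<open>r = r\<^sup>*\<close>, \<open>\<nu> = \<parallel>N\<parallel>\<close>, and take \<open>\<mu>\<close> so small that
  \<open>\<mu> \<surd>r \<parallel>X\<^sup>*\<parallel> < \<lambda>\<close>. As \<open>\<nu>\<^sup>2/2 \<le> \<lambda>\<close>, the level condition gives
  \<open>\<parallel>X - Y\<parallel>\<^sup>2/2 + \<lambda> (p + q) < 2 \<lambda> + 2 \<lambda> r\<close>, where \<open>p, q\<close> count the nonzero columns of \<open>U, V\<close>.
  Both \<open>p\<close> and \<open>q\<close> bound the nonnegative rank of \<open>Y\<close>, which is therefore at most \<open>r\<close>.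
  If it were smaller, then \<open>d = r - rank Y \<ge> 1\<close>. The right singular vectors of \<open>X\<^sup>*\<close> with singular
  value at least \<open>\<sigma>\<close> span a space of dimension at least \<open>r\<close>, which meets the kernel of \<open>Y\<close> in dimension at least
  \<open>d\<close>; summing over an orthonormal basis of the intersection, \<open>\<parallel>X\<^sup>* - Y\<parallel>\<^sup>2 \<ge> d \<sigma>\<^sup>2\<close>. Hence
  \<open>\<parallel>X - Y\<parallel>\<^sup>2 \<ge> d (\<sigma> - \<nu>)\<^sup>2 \<ge> 32 d \<lambda>\<close>, and \<open>p, q \<ge> rank Y\<close> yields \<open>16 d < 2 + 2 d\<close>, which is absurd.
\<close>

section \<open>Spectral theorem for self-adjoint maps\<close>

text \<open>The orthogonal complement \<open>T\<close> of the eigenvectors is invariant under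
  \<open>f\<close>. If \<open>T\<close> were nonzero, a maximizer of the Rayleigh quotient on its
  unit sphere would be an eigenvector inside \<open>T\<close>, hence orthogonal to itself.\<close>

lemma self_adjoint_eigenvectors_span:
  fixes f :: "'a::euclidean_space \<Rightarrow> 'a"
  assumes lin: "linear f" and adj: "\<And>x y. f x \<bullet> y = x \<bullet> f y"
  shows "span {v. \<exists>c. f v = c *\<^sub>R v} = UNIV"
proof (rule ccontr)
  let ?E = "{v. \<exists>c. f v = c *\<^sub>R v}"
  interpret linear f by (fact lin)
  assume "span ?E \<noteq> UNIV"
  then have "dim ?E < DIM('a)"
    using dim_eq_full dim_subset_UNIV le_neq_implies_less by blast
  then obtain x0 where x0: "x0 \<noteq> 0" "\<And>y. y \<in> span ?E \<Longrightarrow> orthogonal x0 y"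
    by (rule orthogonal_to_subspace_exists) blast
  define T where "T = ?E\<^sup>\<bottom>"
  have subT: "subspace T"
    by (simp add: T_def subspace_orthogonal_comp)
  have fT: "f x \<in> T" if "x \<in> T" for x
  proof -
    have "y \<bullet> f x = 0" if y: "f y = c *\<^sub>R y" for y c
    proof -
      have "y \<bullet> x = 0"
        using \<open>x \<in> T\<close> y by (auto simp: T_def orthogonal_comp_def orthogonal_def)
      then show ?thesis
        by (simp add: adj[symmetric] y)
    qed
    then show ?thesis
      by (auto simp: T_def orthogonal_comp_def orthogonal_def)
  qed
  have "x0 \<in> T"
    using x0 by (auto simp: T_def orthogonal_comp_def orthogonal_commute span_base)
  define K where "K = sphere 0 1 \<inter> T"
  have "compact K"
    unfolding K_def by (simp add: closed_subspace compact_Int_closed subT)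
  moreover have "(1 / norm x0) *\<^sub>R x0 \<in> K"
    using \<open>x0 \<noteq> 0\<close> \<open>x0 \<in> T\<close> by (simp add: K_def subT subspace_scale)
  then have "K \<noteq> {}"
    by blast
  moreover have "continuous_on K (\<lambda>x. x \<bullet> f x)"
    by (intro continuous_intros linear_continuous_on linear_linear[THEN iffD2] lin)
  ultimately obtain x where "x \<in> K" and xmax: "\<And>y. y \<in> K \<Longrightarrow> y \<bullet> f y \<le> x \<bullet> f x"
    using continuous_attains_sup by metis
  then have "x \<in> T" and "norm x = 1"
    by (auto simp: K_def)
  \<comment> \<open>\<open>M\<close> is the maximal Rayleigh quotient on \<open>T\<close>; it turns
    out to be the eigenvalue of \<open>x\<close>.\<close>
  define M where "M = x \<bullet> f x"
  have M: "z \<bullet> f z \<le> M * (z \<bullet> z)" if "z \<in> T" for z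
  proof (cases "z = 0")
    case False
    then have "(1 / norm z) *\<^sub>R z \<in> K"
      using that by (simp add: K_def subT subspace_scale)
    then have "((1 / norm z) *\<^sub>R z) \<bullet> f ((1 / norm z) *\<^sub>R z) \<le> M"
      unfolding M_def by (rule xmax)
    then have "(z \<bullet> f z) / (norm z)\<^sup>2 \<le> M"
      by (simp add: scale power2_eq_square field_simps)
    with False show ?thesis
      by (simp add: divide_simps power2_norm_eq_inner split: if_splits)
  qed simp
  \<comment> \<open>The form \<open>M |z|\<^sup>2 - z \<bullet> f z\<close> is nonnegative on \<open>T\<close> and vanishes at \<open>x\<close>, so its gradient \<open>2 y\<close> at \<open>x\<close> is zero.\<close>
  define y where "y = M *\<^sub>R x - f x"
  have "y \<in> T"
    using \<open>x \<in> T\<close> fT by (simp add: y_def subT subspace_diff subspace_scale)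
  define a where "a = y \<bullet> y"
  define b where "b = M * (y \<bullet> y) - y \<bullet> f y"
  have "b \<ge> 0"
    using M[OF \<open>y \<in> T\<close>] by (simp add: b_def)
  have quad: "0 \<le> 2 * t * a + t\<^sup>2 * b" for t
  proof -
    have "x + t *\<^sub>R y \<in> T"
      using \<open>x \<in> T\<close> \<open>y \<in> T\<close> by (simp add: subT subspace_add subspace_scale)
    then have "0 \<le> M * ((x + t *\<^sub>R y) \<bullet> (x + t *\<^sub>R y)) - (x + t *\<^sub>R y) \<bullet> f (x + t *\<^sub>R y)"
      using M by simp
    also have "\<dots> = 2 * t * (M * (x \<bullet> y) - f x \<bullet> y) + t\<^sup>2 * b"
    proof -
      have "x \<bullet> x = 1"
        using \<open>norm x = 1\<close> by (simp add: norm_eq_1)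
      moreover have "x \<bullet> f y = f x \<bullet> y"
        by (simp add: adj)
      ultimately show ?thesis
        by (simp add: add scale inner_add_left inner_add_right b_def M_def power2_eq_square
            algebra_simps inner_commute)
    qed
    also have "M * (x \<bullet> y) - f x \<bullet> y = a"
      by (simp add: a_def y_def inner_diff_left)
    finally show ?thesis .
  qed
  have "a = 0"
  proof -
    \<comment> \<open>A \<open>t\<close> of sign opposite to \<open>a\<close> makes the linear term
      win. The denominator \<open>b + 1\<close> instead of \<open>b\<close> covers the case
      \<open>b = 0\<close>.\<close>
    have "0 \<le> 2 * (- a / (b + 1)) * a + (- a / (b + 1))\<^sup>2 * b"
      by (rule quad)
    also have "\<dots> = - (a\<^sup>2 * (b + 2)) / (b + 1)\<^sup>2"
      using \<open>b \<ge> 0\<close> by (simp add: divide_simps power2_eq_square) (simp add: algebra_simps)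
    finally have "a\<^sup>2 * (b + 2) \<le> 0"
      using \<open>b \<ge> 0\<close> by (simp add: divide_simps split: if_splits)
    with \<open>b \<ge> 0\<close> show ?thesis
      by (smt (verit) mult_pos_pos zero_less_power2)
  qed
  then have "f x = M *\<^sub>R x"
    by (simp add: a_def y_def)
  then have "x \<in> ?E"
    by blast
  with \<open>x \<in> T\<close> have "x \<bullet> x = 0"
    unfolding T_def orthogonal_comp_def orthogonal_def by blast
  with \<open>norm x = 1\<close> show False
    by simp
qed

section \<open>Frobenius distance to matrices of smaller rank\<close>

text \<open>Bessel's inequality: \<open>?p\<close> is the orthogonal projection of \<open>x\<close>
  to the span of \<open>B\<close>, and the squared length of \<open>x - ?p\<close> is
  nonnegative.\<close>

lemma orthonormal_sum_inner_le:
  fixes x :: "'a::real_inner"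
  assumes "finite B" "pairwise orthogonal B" "\<And>b. b \<in> B \<Longrightarrow> norm b = 1"
  shows "(\<Sum>b\<in>B. (x \<bullet> b)\<^sup>2) \<le> (norm x)\<^sup>2"
proof -
  let ?p = "\<Sum>b\<in>B. (x \<bullet> b) *\<^sub>R b"
  have "?p \<bullet> ?p = (\<Sum>b\<in>B. (x \<bullet> b)\<^sup>2)"
  proof -
    have "?p \<bullet> c = x \<bullet> c" if "c \<in> B" for c
    proof -
      have "?p \<bullet> c = (\<Sum>b\<in>B. if b = c then x \<bullet> c else 0)"
        unfolding inner_sum_left using assms that
        by (intro sum.cong) (auto simp: pairwise_def orthogonal_def norm_eq_1)
      then show ?thesis
        using assms that by simp
    qed
    then show ?thesis
      by (simp add: inner_sum_right power2_eq_square)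
  qed
  moreover have "x \<bullet> ?p = (\<Sum>b\<in>B. (x \<bullet> b)\<^sup>2)"
    by (simp add: inner_sum_right power2_eq_square)
  moreover have "0 \<le> (x - ?p) \<bullet> (x - ?p)"
    by simp
  ultimately show ?thesis
    by (simp add: inner_diff_left inner_diff_right inner_commute power2_norm_eq_inner)
qed

text \<open>After swapping the sums, this is Bessel's inequality for each row of
  \<open>A\<close>.\<close>

lemma sum_norm_mult_orthonormal_le:
  fixes A :: "real^'m^'n"
  assumes "finite B" "pairwise orthogonal B" "\<And>b. b \<in> B \<Longrightarrow> norm b = 1"
  shows "(\<Sum>b\<in>B. (norm (A *v b))\<^sup>2) \<le> (norm A)\<^sup>2"
proof -
  have "(\<Sum>b\<in>B. (norm (A *v b))\<^sup>2) = (\<Sum>b\<in>B. \<Sum>i\<in>UNIV. (A $ i \<bullet> b)\<^sup>2)"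
    by (simp add: norm_vec_def L2_set_def matrix_mult_dot sum_nonneg)
  also have "\<dots> = (\<Sum>i\<in>UNIV. \<Sum>b\<in>B. (A $ i \<bullet> b)\<^sup>2)"
    by (rule sum.swap)
  also have "\<dots> \<le> (\<Sum>i\<in>UNIV. (norm (A $ i))\<^sup>2)"
    by (intro sum_mono orthonormal_sum_inner_le assms)
  also have "\<dots> = (norm A)\<^sup>2"
    by (simp add: norm_vec_def[of A] L2_set_def sum_nonneg)
  finally show ?thesis .
qed

text \<open>The kernel of \<open>Y\<close> is the orthogonal complement of its row space, so it has
  codimension \<open>rank Y\<close>; the dimension formula for a sum of two subspaces gives the
  rest.\<close>

lemma dim_Int_kernel_ge:
  fixes Y :: "real^'m^'n"
  assumes "subspace W"
  shows "dim W \<le> dim (W \<inter> {v. Y *v v = 0}) + rank Y"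
proof -
  let ?K = "{v. Y *v v = 0}"
  have rows: "rows Y = range (($) Y)"
    by (auto simp: rows_def row_def)
  have "?K = {y. \<forall>x\<in>rows Y. orthogonal x y}"
    unfolding rows by (auto simp: orthogonal_def vec_eq_iff matrix_mult_dot)
  also have "\<dots> = {y \<in> UNIV. \<forall>x\<in>span (rows Y). orthogonal x y}"
  proof -
    have "orthogonal x y" if "\<forall>x\<in>rows Y. orthogonal x y" "x \<in> span (rows Y)" for x y
      using orthogonal_to_span[OF that(2), of y] that(1) by (simp add: orthogonal_commute)
    then show ?thesis
      by (auto simp: span_base)
  qed
  finally have "dim (rows Y) + dim ?K = CARD('m)"
    using dim_subspace_orthogonal_to_vectors[of "span (rows Y)" UNIV] by simp
  moreover have "subspace ?K"
    by (simp add: subspace_def matrix_vector_right_distrib matrix_vector_mult_scaleR)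
  then have "dim {x + y |x y. x \<in> W \<and> y \<in> ?K} + dim (W \<inter> ?K) = dim W + dim ?K"
    using dim_sums_Int assms by blast
  moreover have "dim {x + y |x y. x \<in> W \<and> y \<in> ?K} \<le> CARD('m)"
    using dim_subset_UNIV[where 'a = "real^'m"] by simp
  ultimately show ?thesis
    by (simp add: row_rank_def)
qed

text \<open>On the part of \<open>W\<close> killed by \<open>Y\<close>, the matrices
  \<open>A - Y\<close> and \<open>A\<close> act alike. Each vector of an orthonormal basis of that
  part therefore contributes at least \<open>s\<^sup>2\<close>.\<close>

lemma rank_le_frobenius_distance:
  fixes A Y :: "real^'m^'n"
  assumes "subspace W" and large: "\<And>w. w \<in> W \<Longrightarrow> s * norm w \<le> norm (A *v w)" and "0 \<le> s"
  shows "(real (dim W) - real (rank Y)) * s\<^sup>2 \<le> (norm (A - Y))\<^sup>2"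
proof -
  let ?S = "W \<inter> {v. Y *v v = 0}"
  have "subspace ?S"
    using \<open>subspace W\<close>
    by (simp add: subspace_def matrix_vector_right_distrib matrix_vector_mult_scaleR)
  then obtain B where B: "B \<subseteq> ?S" "pairwise orthogonal B" "\<And>x. x \<in> B \<Longrightarrow> norm x = 1"
      "independent B" "card B = dim ?S"
    using orthonormal_basis_subspace by metis
  have "finite B"
    using B(4) by (rule independent_imp_finite)
  have "(real (dim W) - real (rank Y)) * s\<^sup>2 \<le> real (card B) * s\<^sup>2"
    using dim_Int_kernel_ge[OF \<open>subspace W\<close>, of Y] B(5) by (intro mult_right_mono) auto
  also have "\<dots> = (\<Sum>b\<in>B. s\<^sup>2)"
    by simp
  also have "\<dots> \<le> (\<Sum>b\<in>B. (norm ((A - Y) *v b))\<^sup>2)"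
  proof (intro sum_mono power_mono \<open>0 \<le> s\<close>)
    fix b assume "b \<in> B"
    then have "b \<in> W" "Y *v b = 0"
      using B(1) by auto
    then show "s \<le> norm ((A - Y) *v b)"
      using B(3)[OF \<open>b \<in> B\<close>] large[of b] by (simp add: matrix_vector_mult_diff_rdistrib)
  qed
  also have "\<dots> \<le> (norm (A - Y))\<^sup>2"
    using \<open>finite B\<close> B by (intro sum_norm_mult_orthonormal_le)
  finally show ?thesis .
qed

section \<open>Singular values and singular vectors\<close>

lemma inner_transpose_mult:
  fixes A :: "real^'m^'n"
  shows "((transpose A ** A) *v u) \<bullet> v = (A *v u) \<bullet> (A *v v)"
  by (simp add: matrix_vector_mul_assoc[symmetric] dot_lmul_matrix)

text \<open>Eigenvectors of the symmetric matrix \<open>transpose A ** A\<close> for distinct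
  eigenvalues are orthogonal; nonnegativity of \<open>s\<close> and \<open>t\<close> keeps their
  squares distinct.\<close>

lemma singular_space_orthogonal:
  fixes A :: "real^'m^'n"
  assumes "u \<in> singular_space A s" "v \<in> singular_space A t" "0 \<le> s" "0 \<le> t" "s \<noteq> t"
  shows "u \<bullet> v = 0"
proof -
  have "s\<^sup>2 * (u \<bullet> v) = (A *v u) \<bullet> (A *v v)"
    using assms(1) inner_transpose_mult[of A u v] by (simp add: singular_space_def)
  moreover have "t\<^sup>2 * (u \<bullet> v) = (A *v u) \<bullet> (A *v v)"
    using assms(2) inner_transpose_mult[of A v u] by (simp add: singular_space_def inner_commute)
  ultimately have "(s\<^sup>2 - t\<^sup>2) * (u \<bullet> v) = 0"
    by (simp add: left_diff_distrib)
  then show ?thesis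
    using assms by (simp add: power2_eq_iff_nonneg)
qed

lemma subspace_singular_space: "subspace (singular_space A s)"
  by (simp add: subspace_def singular_space_def matrix_vector_right_distrib
      matrix_vector_mult_scaleR scaleR_add_right mult.commute)

text \<open>An eigenvalue \<open>c\<close> of \<open>transpose A ** A\<close> with eigenvector
  \<open>v \<noteq> 0\<close> is nonnegative, because \<open>c * (v \<bullet> v)\<close> is the
  squared norm of \<open>A *v v\<close>. Hence \<open>sqrt c\<close> is a singular value, and the
  spectral theorem applies.\<close>

lemma span_singular_spaces:
  fixes A :: "real^'m^'n"
  shows "span (\<Union>t\<in>singular_values A. singular_space A t) = UNIV" (is "span ?S = UNIV")
proof -
  have "((transpose A ** A) *v x) \<bullet> y = x \<bullet> ((transpose A ** A) *v y)" for x y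
    using inner_transpose_mult[of A x y] inner_transpose_mult[of A y x] by (simp add: inner_commute)
  then have "span {v. \<exists>c. (transpose A ** A) *v v = c *\<^sub>R v} = UNIV"
    by (rule self_adjoint_eigenvectors_span[OF matrix_vector_mul_linear])
  moreover have "v \<in> span ?S" if c: "(transpose A ** A) *v v = c *\<^sub>R v" for v c
  proof (cases "v = 0")
    case False
    have "c * (v \<bullet> v) = (A *v v) \<bullet> (A *v v)"
      using inner_transpose_mult[of A v v] c by simp
    then have "0 \<le> c * (v \<bullet> v)"
      by simp
    then have "0 \<le> c"
      using False by (simp add: power2_norm_eq_inner[symmetric] zero_le_mult_iff)
    then have "v \<in> singular_space A (sqrt c)"
      using c by (simp add: singular_space_def)
    moreover from this False \<open>0 \<le> c\<close> have "sqrt c \<in> singular_values A"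
      by (auto simp: singular_values_def)
    ultimately show ?thesis
      by (intro span_base) blast
  qed (simp add: span_zero)
  then have "{v. \<exists>c. (transpose A ** A) *v v = c *\<^sub>R v} \<subseteq> span ?S"
    by blast
  ultimately show ?thesis
    using span_minimal[OF _ subspace_span] by blast
qed

text \<open>Orthonormal bases of the singular spaces are glued together, which turns the
  multiplicities counted in \<open>singular_value\<close> into cardinalities of orthonormal
  sets.\<close>

lemma singular_vectors_orthonormal_basis:
  fixes A :: "real^'m^'n"
  obtains B where
    "\<And>t. t \<in> singular_values A \<Longrightarrow> B t \<subseteq> singular_space A t \<and> B t \<noteq> {}"
    "\<And>T. T \<subseteq> singular_values A \<Longrightarrow> pairwise orthogonal (\<Union> (B ` T))"
    "\<And>t b. b \<in> B t \<Longrightarrow> norm b = 1"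
    "\<And>T. T \<subseteq> singular_values A \<Longrightarrow> card (\<Union> (B ` T)) = (\<Sum>t\<in>T. dim (singular_space A t))"
    "span (\<Union> (B ` singular_values A)) = UNIV"
    "finite (singular_values A)"
proof -
  have "\<exists>B. B \<subseteq> singular_space A t \<and> pairwise orthogonal B \<and> (\<forall>x\<in>B. norm x = 1)
      \<and> independent B \<and> card B = dim (singular_space A t) \<and> span B = singular_space A t" for t
    by (rule orthonormal_basis_subspace[OF subspace_singular_space[of A t]]) blast
  then obtain B where B: "\<And>t. B t \<subseteq> singular_space A t" "\<And>t. pairwise orthogonal (B t)"
      "\<And>t x. x \<in> B t \<Longrightarrow> norm x = 1" "\<And>t. independent (B t)"
      "\<And>t. card (B t) = dim (singular_space A t)" "\<And>t. span (B t) = singular_space A t"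
    by metis
  have pw: "pairwise orthogonal (\<Union> (B ` T))" if T: "T \<subseteq> singular_values A" for T
  proof (rule pairwiseI)
    fix x y assume "x \<in> \<Union> (B ` T)" "y \<in> \<Union> (B ` T)" "x \<noteq> y"
    then obtain s t where st: "s \<in> T" "t \<in> T" "x \<in> B s" "y \<in> B t"
      by blast
    show "orthogonal x y"
    proof (cases "s = t")
      case True
      then show ?thesis
        using B(2)[of s] st \<open>x \<noteq> y\<close> by (simp add: pairwise_def)
    next
      case False
      have "0 \<le> s" "0 \<le> t"
        using T st by (auto simp: singular_values_def)
      then show ?thesis
        using singular_space_orthogonal[of x A s y t] st B(1) False by (auto simp: orthogonal_def)
    qed
  qed
  have ne: "B t \<noteq> {}" if "t \<in> singular_values A" for t
    using B(6)[of t] that by (auto simp: singular_values_def)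
  have disj: "B s \<inter> B t = {}" if "s \<in> singular_values A" "t \<in> singular_values A" "s \<noteq> t" for s t
  proof -
    have "False" if "x \<in> B s" "x \<in> B t" for x
    proof -
      have "x \<bullet> x = 0"
        using singular_space_orthogonal[of x A s x t] B(1) that
          \<open>s \<in> singular_values A\<close> \<open>t \<in> singular_values A\<close> \<open>s \<noteq> t\<close>
        by (auto simp: singular_values_def)
      then show False
        using B(3)[OF that(1)] by simp
    qed
    then show ?thesis
      by blast
  qed
  have ind: "independent (\<Union> (B ` singular_values A))"
    using pw[of "singular_values A"] B(3) by (intro pairwise_orthogonal_independent) fastforce+
  have fin: "finite (singular_values A)"
  proof -
    \<comment> \<open>One basis vector per singular value embeds \<open>singular_values A\<close>
      into an independent, hence finite, set.\<close>
    define g where "g t = (SOME x. x \<in> B t)" for t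
    have g: "g t \<in> B t" if "t \<in> singular_values A" for t
      using ne[OF that] by (simp add: g_def some_in_eq)
    have "inj_on g (singular_values A)"
      using disj g by (metis disjoint_iff inj_onI)
    moreover have "g ` singular_values A \<subseteq> \<Union> (B ` singular_values A)"
      using g by blast
    ultimately show ?thesis
      using independent_imp_finite[OF ind] finite_imageD finite_subset by metis
  qed
  have card: "card (\<Union> (B ` T)) = (\<Sum>t\<in>T. dim (singular_space A t))"
    if T: "T \<subseteq> singular_values A" for T
  proof -
    have "finite T"
      using T fin finite_subset by blast
    moreover have "\<forall>t\<in>T. finite (B t)"
      using B(4) independent_imp_finite by blast
    ultimately show ?thesis
      using T disj B(5) by (subst card_UN_disjoint) (auto simp: subset_iff)
  qed
  have "(\<Union>t\<in>singular_values A. singular_space A t) \<subseteq> span (\<Union> (B ` singular_values A))"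
  proof
    fix v assume "v \<in> (\<Union>t\<in>singular_values A. singular_space A t)"
    then obtain t where "t \<in> singular_values A" "v \<in> span (B t)"
      using B(6) by blast
    moreover have "span (B t) \<subseteq> span (\<Union> (B ` singular_values A))"
      using \<open>t \<in> singular_values A\<close> by (intro span_mono) blast
    ultimately show "v \<in> span (\<Union> (B ` singular_values A))"
      by blast
  qed
  then have "span (\<Union> (B ` singular_values A)) = UNIV"
    using span_singular_spaces[of A] by (metis span_mono span_span top.extremum_uniqueI)
  then show ?thesis
    using B(1,3) ne pw card fin by (intro that[of B]) auto
qed

text \<open>\<open>W\<close> is spanned by the right singular vectors \<open>b\<close> whose
  singular value \<open>t\<close> is at least \<open>singular_value k A\<close>. For
  \<open>w\<close> in \<open>W\<close>, the squared norm of \<open>A *v w\<close> is the sum of all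
  \<open>t\<^sup>2 * (w \<bullet> b)\<^sup>2\<close>.\<close>

lemma singular_value_large_subspace:
  fixes A :: "real^'m^'n"
  assumes "k \<le> CARD('m)"
  obtains W where "subspace W" "k \<le> dim W" "0 \<le> singular_value k A"
    "\<And>w. w \<in> W \<Longrightarrow> singular_value k A * norm w \<le> norm (A *v w)"
proof -
  obtain B where
    BS: "\<And>t. t \<in> singular_values A \<Longrightarrow> B t \<subseteq> singular_space A t \<and> B t \<noteq> {}" and
    pw: "\<And>T. T \<subseteq> singular_values A \<Longrightarrow> pairwise orthogonal (\<Union> (B ` T))" and
    B1: "\<And>t b. b \<in> B t \<Longrightarrow> norm b = 1" and
    card: "\<And>T. T \<subseteq> singular_values A \<Longrightarrow> card (\<Union> (B ` T)) = (\<Sum>t\<in>T. dim (singular_space A t))" and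
    sp: "span (\<Union> (B ` singular_values A)) = UNIV" and
    fin: "finite (singular_values A)"
    by (rule singular_vectors_orthonormal_basis[of A]) (rule that)
  have ind: "independent (\<Union> (B ` T))" if "T \<subseteq> singular_values A" for T
    using pw[OF that] B1 by (intro pairwise_orthogonal_independent) fastforce+
  have cardm: "card (\<Union> (B ` singular_values A)) = CARD('m)"
    using dim_span_eq_card_independent[OF ind[OF order.refl]] sp by simp
  then have "singular_values A \<noteq> {}"
    by auto
  define C where "C = {s \<in> singular_values A.
    k \<le> (\<Sum>t\<in>{t \<in> singular_values A. s \<le> t}. dim (singular_space A t))}"
  have "finite C"
    using fin by (simp add: C_def)
  \<comment> \<open>The least singular value counts all multiplicities, which add up to
    \<open>CARD('m)\<close>. So \<open>C\<close> is nonempty and its \<open>Max\<close> is a genuine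
    element.\<close>
  moreover have "Min (singular_values A) \<in> C"
  proof -
    have "{t \<in> singular_values A. Min (singular_values A) \<le> t} = singular_values A"
      using fin by auto
    then show ?thesis
      using \<open>singular_values A \<noteq> {}\<close> fin assms cardm card[OF order.refl] by (simp add: C_def)
  qed
  ultimately have "Max C \<in> C"
    using Max_in by blast
  define \<sigma> where "\<sigma> = singular_value k A"
  have "\<sigma> = Max C"
    by (simp add: \<sigma>_def C_def singular_value_def)
  with \<open>Max C \<in> C\<close> have "\<sigma> \<in> C"
    by simp
  define T where "T = {t \<in> singular_values A. \<sigma> \<le> t}"
  have T: "T \<subseteq> singular_values A"
    by (auto simp: T_def)
  have "0 \<le> \<sigma>" and k: "k \<le> card (\<Union> (B ` T))"
    using \<open>\<sigma> \<in> C\<close> card[OF T] by (auto simp: C_def T_def singular_values_def)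
  let ?B = "\<Union> (B ` T)"
  have finB: "finite ?B"
    using ind[OF T] by (rule independent_imp_finite)
  have "\<sigma> * norm w \<le> norm (A *v w)" if w: "w \<in> span ?B" for w
  proof (rule power2_le_imp_le)
    have expand: "(\<Sum>b\<in>?B. (w \<bullet> b) *\<^sub>R b) = w"
      using B1 by (intro orthonormal_basis_expand pw T w finB) blast
    have "(\<sigma> * norm w)\<^sup>2 = (\<Sum>b\<in>?B. \<sigma>\<^sup>2 * (w \<bullet> b)\<^sup>2)"
    proof -
      have "(norm w)\<^sup>2 = w \<bullet> (\<Sum>b\<in>?B. (w \<bullet> b) *\<^sub>R b)"
        by (simp add: expand power2_norm_eq_inner)
      also have "\<dots> = (\<Sum>b\<in>?B. (w \<bullet> b)\<^sup>2)"
        by (simp add: inner_sum_right power2_eq_square)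
      finally show ?thesis
        by (simp add: power_mult_distrib sum_distrib_left)
    qed
    also have "\<dots> \<le> (\<Sum>b\<in>?B. (w \<bullet> b) * (((transpose A ** A) *v b) \<bullet> w))"
    proof (rule sum_mono)
      fix b assume "b \<in> ?B"
      then obtain t where t: "t \<in> T" "b \<in> B t"
        by blast
      then have b: "(transpose A ** A) *v b = t\<^sup>2 *\<^sub>R b"
        using BS T by (auto simp: singular_space_def)
      have "\<sigma>\<^sup>2 \<le> t\<^sup>2"
        using t \<open>0 \<le> \<sigma>\<close> by (auto simp: T_def intro: power_mono)
      then have "\<sigma>\<^sup>2 * (w \<bullet> b)\<^sup>2 \<le> t\<^sup>2 * (w \<bullet> b)\<^sup>2"
        by (intro mult_right_mono) auto
      then show "\<sigma>\<^sup>2 * (w \<bullet> b)\<^sup>2 \<le> (w \<bullet> b) * (((transpose A ** A) *v b) \<bullet> w)"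
        by (simp add: b power2_eq_square inner_commute mult_ac)
    qed
    also have "\<dots> = (A *v w) \<bullet> (A *v w)"
    proof -
      have "(transpose A ** A) *v w = (\<Sum>b\<in>?B. (w \<bullet> b) *\<^sub>R ((transpose A ** A) *v b))"
        by (subst expand[symmetric]) (simp only: vec.linear_sum matrix_vector_mult_scaleR
            linear_sum[OF matrix_vector_mul_linear])
      then have "((transpose A ** A) *v w) \<bullet> w = (\<Sum>b\<in>?B. (w \<bullet> b) * (((transpose A ** A) *v b) \<bullet> w))"
        by (simp add: inner_sum_left)
      then show ?thesis
        by (simp add: inner_transpose_mult)
    qed
    finally show "(\<sigma> * norm w)\<^sup>2 \<le> (norm (A *v w))\<^sup>2"
      by (simp add: power2_norm_eq_inner)
  qed simp
  moreover have "k \<le> dim (span ?B)"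
    using k ind[OF T] by (simp add: dim_eq_card_independent)
  ultimately show ?thesis
    using that[of "span ?B"] \<open>0 \<le> \<sigma>\<close> by (simp add: \<sigma>_def)
qed

text \<open>A weak form of the Eckart-Young bound: every missing unit of rank costs at least the
  square of the \<open>k\<close>-th singular value.\<close>

corollary frobenius_distance_ge_singular_value:
  fixes A Y :: "real^'m^'n"
  assumes "rank Y \<le> k" "k \<le> CARD('m)"
  shows "0 \<le> singular_value k A"
    and "real (k - rank Y) * (singular_value k A)\<^sup>2 \<le> (norm (A - Y))\<^sup>2"
proof -
  obtain W where W: "subspace W" "k \<le> dim W" "0 \<le> singular_value k A"
    "\<And>w. w \<in> W \<Longrightarrow> singular_value k A * norm w \<le> norm (A *v w)"
    using singular_value_large_subspace[OF assms(2), of A] by blast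
  show "0 \<le> singular_value k A"
    by (fact W(3))
  have "real (k - rank Y) * (singular_value k A)\<^sup>2 \<le> (real (dim W) - real (rank Y)) * (singular_value k A)\<^sup>2"
    using W(2) assms by (intro mult_right_mono) auto
  also have "\<dots> \<le> (norm (A - Y))\<^sup>2"
    using W by (intro rank_le_frobenius_distance) auto
  finally show "real (k - rank Y) * (singular_value k A)\<^sup>2 \<le> (norm (A - Y))\<^sup>2" .
qed

section \<open>Rank and nonnegative rank of a factorization\<close>

text \<open>The range lies in the span of the \<open>s\<close> columns of \<open>B\<close>.\<close>

lemma rank_mult_transpose_le: "rank (mult_transpose s B C) \<le> s"
proof -
  have "range (\<lambda>x. mult_transpose s B C *v x) \<subseteq> span (B ` {..<s})"
  proof
    fix y assume "y \<in> range (\<lambda>x. mult_transpose s B C *v x)"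
    then obtain x where y: "y = mult_transpose s B C *v x"
      by blast
    have "y = (\<Sum>j<s. (C j \<bullet> x) *\<^sub>R B j)"
    proof -
      have "y $ i = (\<Sum>j<s. (C j \<bullet> x) *\<^sub>R B j) $ i" for i
      proof -
        have "y $ i = (\<Sum>k\<in>UNIV. \<Sum>j<s. B j $ i * C j $ k * x $ k)"
          by (simp add: y mult_transpose_def matrix_vector_mult_def sum_distrib_right)
        also have "\<dots> = (\<Sum>j<s. \<Sum>k\<in>UNIV. B j $ i * C j $ k * x $ k)"
          by (rule sum.swap)
        also have "\<dots> = (\<Sum>j<s. (C j \<bullet> x) *\<^sub>R B j) $ i"
          by (simp add: inner_vec_def sum_distrib_left sum_distrib_right mult_ac)
        finally show ?thesis .
      qed
      then show ?thesis
        by (simp add: vec_eq_iff)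
    qed
    then show "y \<in> span (B ` {..<s})"
      by (auto intro!: span_sum span_mul intro: span_base)
  qed
  then have "rank (mult_transpose s B C) \<le> dim (B ` {..<s})"
    unfolding rank_dim_range by (metis dim_span dim_subset)
  also have "\<dots> \<le> card (B ` {..<s})"
    by (simp add: dim_le_card')
  also have "\<dots> \<le> s"
    using card_image_le[of "{..<s}" B] by simp
  finally show ?thesis .
qed

text \<open>Columns outside \<open>P\<close> contribute nothing to the product, so the others,
  renumbered by \<open>h\<close>, still factor it. With \<open>P\<close> left open, the lemma serves
  the nonzero columns of \<open>U\<close> and of \<open>V\<close> alike.\<close>

lemma nonneg_rank_mult_transpose_le_card:
  assumes zero: "\<And>j. j < r \<Longrightarrow> \<not> P j \<Longrightarrow> U j = 0 \<or> V j = 0"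
    and "nonneg_columns r U" "nonneg_columns r V"
  shows "nonneg_rank (mult_transpose r U V) \<le> card {j. j < r \<and> P j}"
proof -
  define J where J: "J = {j. j < r \<and> P j}"
  have "finite J"
    by (simp add: J)
  then obtain h where h: "bij_betw h {..<card J} J"
    using bij_betw_from_nat_into_finite by blast
  let ?s = "card J"
  let ?B = "\<lambda>j. if j < ?s then U (h j) else 0"
  let ?C = "\<lambda>j. if j < ?s then V (h j) else 0"
  have hJ: "h j < r" if "j < ?s" for j
    using that h J by (auto simp: bij_betw_def)
  have "mult_transpose r U V = mult_transpose ?s ?B ?C"
  proof -
    have "(\<Sum>j<r. U j $ i * V j $ k) = (\<Sum>j<?s. ?B j $ i * ?C j $ k)" for i k
    proof -
      have "(\<Sum>j<r. U j $ i * V j $ k) = (\<Sum>j\<in>J. U j $ i * V j $ k)"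
        using zero by (intro sum.mono_neutral_right) (fastforce simp: J)+
      also have "\<dots> = (\<Sum>j<?s. U (h j) $ i * V (h j) $ k)"
        using sum.reindex_bij_betw[OF h, of "\<lambda>j. U j $ i * V j $ k"] by simp
      also have "\<dots> = (\<Sum>j<?s. ?B j $ i * ?C j $ k)"
        by (intro sum.cong) auto
      finally show ?thesis .
    qed
    then show ?thesis
      by (simp add: mult_transpose_def)
  qed
  moreover have "?B \<in> column_seqs ?s" "?C \<in> column_seqs ?s"
    by (auto simp: column_seqs_def)
  moreover have "nonneg_columns ?s ?B" "nonneg_columns ?s ?C"
    using assms hJ by (auto simp: nonneg_columns_def)
  ultimately show ?thesis
    unfolding nonneg_rank_def J[symmetric] by (intro Least_le) blast
qed

lemma rank_le_nonneg_rank: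
  assumes "nonneg_columns r U" "nonneg_columns r V" "U \<in> column_seqs r" "V \<in> column_seqs r"
  shows "rank (mult_transpose r U V) \<le> nonneg_rank (mult_transpose r U V)"
proof -
  let ?P = "\<lambda>s. \<exists>B\<in>column_seqs s. \<exists>C\<in>column_seqs s.
     nonneg_columns s B \<and> nonneg_columns s C \<and> mult_transpose r U V = mult_transpose s B C"
  have "?P r"
    using assms by blast
  then have "?P (nonneg_rank (mult_transpose r U V))"
    unfolding nonneg_rank_def by (rule LeastI)
  then show ?thesis
    by (metis rank_mult_transpose_le)
qed

theorem proposition4:
  fixes Xs N :: "real^'m^'n" and rs :: nat and lam :: real
  assumes "nonneg_matrix Xs" and "Xs \<noteq> 0"
    and "rank Xs = rs" and "nonneg_rank Xs = rs"
    and "nonneg_matrix (Xs + N)"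
    and "norm N \<le> singular_value rs Xs / 5"
    and "lam > 0"
    and "lam \<in> {1/2 * (norm N)\<^sup>2 .. 1/32 * (singular_value rs Xs - norm N)\<^sup>2}"
  shows "\<exists>\<mu>0>0. \<forall>r>0. \<forall>\<mu>. 0 < \<mu> \<and> \<mu> < \<mu>0 \<longrightarrow>
    (\<forall>U\<in>column_seqs r. \<forall>V\<in>column_seqs r.
       critical_point r (Psi (Xs + N) lam \<mu> r) U V \<and>
       Psi (Xs + N) lam \<mu> r U V
         \<le> ereal (1/2 * (norm N)\<^sup>2 + \<mu> * sqrt (real rs) * norm Xs + 2 * lam * real rs)
       \<longrightarrow> nonneg_rank (mult_transpose r U V) = rs)"
proof -
  define c where "c = sqrt (real rs) * norm Xs"
  have "c \<ge> 0"
    by (simp add: c_def)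
  \<comment> \<open>Adding 1 keeps the denominator positive when \<open>c = 0\<close>. The bound is
    independent of \<open>r\<close>.\<close>
  define \<mu>0 where "\<mu>0 = lam / (c + 1)"
  have "\<mu>0 > 0"
    using \<open>c \<ge> 0\<close> \<open>lam > 0\<close> by (simp add: \<mu>0_def)
  moreover have "nonneg_rank (mult_transpose r U V) = rs"
    if \<mu>: "0 < \<mu>" "\<mu> < \<mu>0" and U: "U \<in> column_seqs r" and V: "V \<in> column_seqs r"
      and level: "Psi (Xs + N) lam \<mu> r U V
         \<le> ereal (1/2 * (norm N)\<^sup>2 + \<mu> * sqrt (real rs) * norm Xs + 2 * lam * real rs)"
    for r \<mu> U V
  proof -
    define Y where "Y = mult_transpose r U V"
    define \<sigma> where "\<sigma> = singular_value rs Xs"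
    define \<nu> where "\<nu> = norm N"
    have "\<mu> * c < lam"
    proof -
      have "\<mu> * c \<le> \<mu> * (c + 1)"
        using \<mu> by simp
      also have "\<dots> < lam"
        using \<mu>(2) \<open>c \<ge> 0\<close> by (simp add: \<mu>0_def pos_less_divide_eq)
      finally show ?thesis .
    qed
    \<comment> \<open>A negative entry would make \<open>Psi\<close> infinite, against the finite
      level.\<close>
    have nn: "nonneg_columns r U" "nonneg_columns r V"
      using level by (auto simp: Psi_def nonneg_indicator_def split: if_splits)
    have "1/2 * (norm (Xs + N - Y))\<^sup>2 + \<mu>/2 * ((cnorm r U)\<^sup>2 + (cnorm r V)\<^sup>2)
        + lam * (real (norm20 r U) + real (norm20 r V)) \<le> 1/2 * \<nu>\<^sup>2 + \<mu> * c + 2 * lam * real rs"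
      using level nn by (simp add: Psi_def nonneg_indicator_def Y_def \<nu>_def c_def mult.assoc)
    moreover have "0 \<le> \<mu>/2 * ((cnorm r U)\<^sup>2 + (cnorm r V)\<^sup>2)"
      using \<mu> by simp
    moreover have "1/2 * \<nu>\<^sup>2 \<le> lam" and gap: "32 * lam \<le> (\<sigma> - \<nu>)\<^sup>2"
      using assms(8) by (auto simp: \<sigma>_def \<nu>_def)
    \<comment> \<open>The noise term and \<open>\<mu> * c\<close> cost at most \<open>lam\<close>
      each, the latter strictly; the nonnegative ridge term is dropped.\<close>
    ultimately have energy: "1/2 * (norm (Xs + N - Y))\<^sup>2
        + lam * (real (norm20 r U) + real (norm20 r V)) < 2 * lam + 2 * lam * real rs"
      using \<open>\<mu> * c < lam\<close> by linarith
    have le_U: "nonneg_rank Y \<le> norm20 r U" and le_V: "nonneg_rank Y \<le> norm20 r V"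
      unfolding Y_def norm20_def
      by (rule nonneg_rank_mult_transpose_le_card[OF _ nn], simp)+
    have le_rank: "rank Y \<le> nonneg_rank Y"
      unfolding Y_def using nn U V by (rule rank_le_nonneg_rank)
    \<comment> \<open>Both column counts dominate \<open>nonneg_rank Y\<close>, so its double is
      below \<open>2 * (rs + 1)\<close>; integrality does the rest.\<close>
    have "nonneg_rank Y \<le> rs"
    proof -
      have "lam * (real (norm20 r U) + real (norm20 r V)) < 2 * lam + 2 * lam * real rs"
        using energy zero_le_power2[of "norm (Xs + N - Y)"] by linarith
      also have "\<dots> = lam * (2 + 2 * real rs)"
        by (simp add: algebra_simps)
      finally have "lam * (real (norm20 r U) + real (norm20 r V)) < lam * (2 + 2 * real rs)" .
      then have "real (norm20 r U) + real (norm20 r V) < 2 + 2 * real rs"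
        using \<open>lam > 0\<close> by simp
      then show ?thesis
        using le_U le_V by linarith
    qed
    moreover have "rs \<le> nonneg_rank Y"
    proof (rule ccontr)
      assume "\<not> rs \<le> nonneg_rank Y"
      then have "rank Y < rs"
        using le_rank by simp
      define d where "d = real (rs - rank Y)"
      have "d \<ge> 1"
        using \<open>rank Y < rs\<close> by (simp add: d_def)
      have "rs \<le> CARD('m)"
        using rank_bound[of Xs] \<open>rank Xs = rs\<close> by simp
      then have "0 \<le> \<sigma>" and dist: "d * \<sigma>\<^sup>2 \<le> (norm (Xs - Y))\<^sup>2"
        using frobenius_distance_ge_singular_value[of Y rs Xs] \<open>rank Y < rs\<close>
        by (auto simp: d_def \<sigma>_def)
      have "\<nu> \<le> \<sigma>" "0 \<le> \<nu>"
        using assms(6) \<open>0 \<le> \<sigma>\<close> by (auto simp: \<sigma>_def \<nu>_def)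
      have "sqrt d * (\<sigma> - \<nu>) \<le> norm (Xs + N - Y)"
      proof -
        have "sqrt d * \<sigma> \<le> norm (Xs - Y)"
          using real_sqrt_le_mono[OF dist] \<open>0 \<le> \<sigma>\<close> by (simp add: real_sqrt_mult)
        moreover have "norm (Xs - Y) \<le> norm (Xs + N - Y) + \<nu>"
          using norm_triangle_ineq4[of "Xs + N - Y" N] by (simp add: \<nu>_def algebra_simps)
        \<comment> \<open>Enlarging the noise by \<open>sqrt d\<close> lets this factor be pulled
          out, so that \<open>d\<close> survives in front of the squared gap.\<close>
        moreover have "\<nu> \<le> sqrt d * \<nu>"
          using \<open>d \<ge> 1\<close> \<open>0 \<le> \<nu>\<close> by (simp add: mult_le_cancel_right1)
        ultimately show ?thesis
          by (simp add: algebra_simps)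
      qed
      then have "(sqrt d * (\<sigma> - \<nu>))\<^sup>2 \<le> (norm (Xs + N - Y))\<^sup>2"
        using \<open>\<nu> \<le> \<sigma>\<close> \<open>d \<ge> 1\<close> by (intro power_mono) auto
      then have "d * (\<sigma> - \<nu>)\<^sup>2 \<le> (norm (Xs + N - Y))\<^sup>2"
        using \<open>d \<ge> 1\<close> by (simp add: power_mult_distrib)
      moreover have "d * (32 * lam) \<le> d * (\<sigma> - \<nu>)\<^sup>2"
        using gap \<open>d \<ge> 1\<close> by (intro mult_left_mono) auto
      moreover have "lam * (2 * real (rank Y)) \<le> lam * (real (norm20 r U) + real (norm20 r V))"
        using \<open>lam > 0\<close> le_rank le_U le_V by (intro mult_left_mono) auto
      \<comment> \<open>The factor 16 is half of the 32 in \<open>gap\<close>. The right side grows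
        only like \<open>2 * d\<close>, which fails once \<open>d \<ge> 1\<close>.\<close>
      ultimately have "16 * d * lam < 2 * lam + 2 * lam * real rs - lam * (2 * real (rank Y))"
        using energy by linarith
      also have "\<dots> = (2 + 2 * d) * lam"
        using \<open>rank Y < rs\<close> by (simp add: d_def of_nat_diff algebra_simps)
      finally have "16 * d < 2 + 2 * d"
        using \<open>lam > 0\<close> by simp
      with \<open>d \<ge> 1\<close> show False
        by simp
    qed
    ultimately show ?thesis
      by (simp add: Y_def)
  qed
  ultimately show ?thesis
    by blast
qed

end
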